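(* Let $N=2k$ with $k\ge 2$. Then the Grundy values are $$\mathcal{G}(F_N)=0,\qquad \mathcal{G}(FI_N)=0,\qquad \mathcal{G}(FM_N)=N-2,\qquad \mathcal{G}(FIM_N)=N-2 .$$
   Context: Coin games. There is a finite collection of identically-looking coins, exactly one of which is counterfeit; all real coins weigh the same. A weighing puts equal numbers of coins on the two pans of a balance scale; its outcome (balance, left lighter, right lighter) is seen by an Observer, who is a perfect reasoner and remembers all weighings. Two players, who know exactly which coin is counterfeit and whether it is heavier or lighter, alternate turns; a move is one weighing that gives the Observer some new information (i.e. strictly shrinks the set of possibilities, each consisting of a coin that could be counterfeit and whether it is lighter or heavier, that are consistent with everything the Observer has seen). Unknown coins without an extra coin. In the games $F_N$, $FI_N$, $FM_N$, $FIM_N$ there are exactly $N$ coins, all unknown, one of which is counterfeit. Initially, from the Observer's viewpoint, each of the $N$ coins may be the counterfeit one and it may be either lighter or heavier than a real coin. A balanced weighing proves the coins on the scale real (they become excluded, and may be used in later weighings). An unbalanced weighing of unknown coins excludes the coins not on the scale; the non-excluded coins on the scale acquire a destiny: those on the lighter pan are destined to be lighter (if counterfeit, then lighter), those on the heavier pan are destined to be heavier. For destined coins, a later unbalanced weighing excludes lighter-destined coins on the heavier pan, heavier-destined coins on the lighter pan, and coins off the scale. Goals and end of game. In $F_N$ and $FM_N$ the Observer's goal is to find the counterfeit coin; in $FI_N$ and $FIM_N$ the goal is to find it and to identify whether it is lighter or heavier. $F_N$ and $FI_N$ are normal play: the game ends when the Observer reaches her goal, and the player who reveals the last necessary piece of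 information wins. $FM_N$ and $FIM_N$ are mis\`ere play: the player who reveals the full information (makes the Observer reach her goal) loses; that is, the game ends when on the next turn the full information is guaranteed to be revealed. Grundy values. $\mathcal{G}(H)=\mathrm{mex}\{\mathcal{G}(H') : H' \text{ an option of } H\}$, where $\mathrm{mex}$ of a set is the least non-negative integer not in it, and an ended game has value $0$. In mis\`ere play, moves that make the Observer reach her goal are not counted as options, so a position from which every move reveals the full information is an ended game with value $0$. *)

theory Defs
  imports Main
begin

text \<open>
  Coins are the numbers below \<open>N\<close>. A possibility is a pair of a coin that could be the
  counterfeit one and the way in which its weight would differ from that of a real coin.
\<close>

datatype bias = Lighter | Heavier

type_synonym possibility = "nat \<times> bias"

definition possibilities :: "nat \<Rightarrow> possibility set" where
  "possibilities N = {..<N} \<times> UNIV"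

definition weighing :: "nat \<Rightarrow> nat set \<Rightarrow> nat set \<Rightarrow> bool" where
  "weighing N A B \<longleftrightarrow> A \<subseteq> {..<N} \<and> B \<subseteq> {..<N} \<and> A \<inter> B = {} \<and> card A = card B"

text \<open>
  Weights are measured relative to a real coin. This and the unit size of the deviation are
  immaterial, since the two pans carry equally many coins and there is a single counterfeit.
\<close>

definition rel_weight :: "possibility \<Rightarrow> nat \<Rightarrow> int" where
  "rel_weight p x =
     (if x = fst p then (case snd p of Lighter \<Rightarrow> - 1 | Heavier \<Rightarrow> 1) else 0)"

text \<open>
  The outcome is \<open>0\<close> for balance, \<open>- 1\<close> if the left pan \<open>A\<close> is lighter,
  \<open>1\<close> if the right pan \<open>B\<close> is lighter.
\<close>

definition outcome :: "nat set \<Rightarrow> nat set \<Rightarrow> possibility \<Rightarrow> int" where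
  "outcome A B p = sgn ((\<Sum>x\<in>A. rel_weight p x) - (\<Sum>x\<in>B. rel_weight p x))"

definition coin_found :: "possibility set \<Rightarrow> bool" where
  "coin_found S \<longleftrightarrow> (\<exists>c. fst ` S = {c})"

definition coin_identified :: "possibility set \<Rightarrow> bool" where
  "coin_identified S \<longleftrightarrow> (\<exists>p. S = {p})"

text \<open>
  A position is the set of possibilities consistent with everything the Observer has seen.
  The outcome of a move is dictated by the actual counterfeit and its actual bias \<open>t\<close>,
  which the players know and which stays fixed throughout the game.
\<close>

definition moves :: "nat \<Rightarrow> possibility \<Rightarrow> possibility set \<Rightarrow> possibility set set" where
  "moves N t S = {S'. S' \<subset> S \<and>
     (\<exists>A B. weighing N A B \<and> S' = {p \<in> S. outcome A B p = outcome A B t})}"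

definition normal_moves ::
  "(possibility set \<Rightarrow> bool) \<Rightarrow> nat \<Rightarrow> possibility \<Rightarrow> possibility set \<Rightarrow> possibility set set" where
  "normal_moves goal N t S = (if goal S then {} else moves N t S)"

text \<open>Under misere play, moves that reach the goal do not count as options.\<close>

definition misere_moves ::
  "(possibility set \<Rightarrow> bool) \<Rightarrow> nat \<Rightarrow> possibility \<Rightarrow> possibility set \<Rightarrow> possibility set set" where
  "misere_moves goal N t S = {S' \<in> normal_moves goal N t S. \<not> goal S'}"

definition mex :: "nat set \<Rightarrow> nat" where
  "mex A = (LEAST n. n \<notin> A)"

definition grundy :: "('p \<Rightarrow> 'p set) \<Rightarrow> 'p \<Rightarrow> nat" where
  "grundy opts = wfrec {(q, p). q \<in> opts p} (\<lambda>g p. mex (g ` opts p))"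

lemma grundy_rec:
  assumes "wf {(q, p). q \<in> opts p}"
  shows "grundy opts p = mex (grundy opts ` opts p)"
proof -
  let ?R = "{(q, p). q \<in> opts p}"
  have "grundy opts p = mex (cut (grundy opts) ?R p ` opts p)"
    unfolding grundy_def by (subst wfrec [OF assms]) (rule refl)
  also have "cut (grundy opts) ?R p ` opts p = grundy opts ` opts p"
    by (rule image_cong) (auto simp: cut_apply)
  finally show ?thesis .
qed

lemma outcome_off_scale:
  assumes "fst p \<notin> A" "fst p \<notin> B"
  shows "outcome A B p = 0"
proof -
  have "(\<Sum>x\<in>A. rel_weight p x) = 0" "(\<Sum>x\<in>B. rel_weight p x) = 0"
    using assms by (auto simp: rel_weight_def intro!: sum.neutral)
  then show ?thesis by (simp add: outcome_def)
qed

lemma wf_moves: "wf {(S', S). S' \<in> moves N t S}"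
proof -
  let ?P = "possibilities N"
  have fin: "finite ?P"
  proof -
    have "(UNIV :: bias set) = {Lighter, Heavier}"
      using bias.exhaust by auto
    then have "finite (UNIV :: bias set)"
      by (metis finite.emptyI finite.insertI)
    then show ?thesis by (simp add: possibilities_def)
  qed
  define m where "m S = (if finite S then card S else Suc (card ?P) + card (S \<inter> ?P))" for S
  have "m S' < m S" if "S' \<in> moves N t S" for S S'
  proof (cases "finite S")
    case True
    moreover from that have "S' \<subset> S" by (simp add: moves_def)
    ultimately show ?thesis
      by (simp add: m_def psubset_card_mono finite_subset [OF psubset_imp_subset])
  next
    case False
    from that obtain A B where AB: "weighing N A B"
      and S': "S' = {p \<in> S. outcome A B p = outcome A B t}" and sub: "S' \<subset> S"
      by (auto simp: moves_def)
    have off: "outcome A B p = 0" if "p \<notin> ?P" for p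
      using AB that by (intro outcome_off_scale) (auto simp: weighing_def possibilities_def mem_Times_iff)
    show ?thesis
    proof (cases "outcome A B t = 0")
      case True
      have "S - S' \<subseteq> ?P"
      proof
        fix p assume "p \<in> S - S'"
        then have "outcome A B p \<noteq> 0" using True by (simp add: S')
        then show "p \<in> ?P" using off by blast
      qed
      then have "finite (S - S')" using fin by (rule finite_subset)
      with False have "infinite S'" using finite_Diff2 by blast
      moreover have "S' \<inter> ?P \<subset> S \<inter> ?P"
        using sub \<open>S - S' \<subseteq> ?P\<close> by blast
      ultimately show ?thesis
        using False fin by (simp add: m_def psubset_card_mono)
    next
      case nz: False
      have "S' \<subseteq> ?P"
      proof
        fix p assume "p \<in> S'"
        then have "outcome A B p \<noteq> 0" using nz by (simp add: S')
        then show "p \<in> ?P" using off by blast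
      qed
      then have "finite S'" "card S' \<le> card ?P"
        using fin by (simp_all add: finite_subset card_mono)
      with False show ?thesis by (simp add: m_def)
    qed
  qed
  then have "{(S', S). S' \<in> moves N t S} \<subseteq> measure m" by auto
  then show ?thesis by (rule wf_subset [OF wf_measure])
qed

lemma wf_normal_moves: "wf {(S', S). S' \<in> normal_moves goal N t S}"
  by (rule wf_subset [OF wf_moves]) (auto simp: normal_moves_def split: if_splits)

lemma wf_misere_moves: "wf {(S', S). S' \<in> misere_moves goal N t S}"
  by (rule wf_subset [OF wf_normal_moves]) (auto simp: misere_moves_def)

lemmas grundy_normal_rec = grundy_rec [OF wf_normal_moves]
lemmas grundy_misere_rec = grundy_rec [OF wf_misere_moves]

definition grundy_F :: "nat \<Rightarrow> possibility \<Rightarrow> nat" where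
  "grundy_F N t = grundy (normal_moves coin_found N t) (possibilities N)"

definition grundy_FI :: "nat \<Rightarrow> possibility \<Rightarrow> nat" where
  "grundy_FI N t = grundy (normal_moves coin_identified N t) (possibilities N)"

definition grundy_FM :: "nat \<Rightarrow> possibility \<Rightarrow> nat" where
  "grundy_FM N t = grundy (misere_moves coin_found N t) (possibilities N)"

definition grundy_FIM :: "nat \<Rightarrow> possibility \<Rightarrow> nat" where
  "grundy_FIM N t = grundy (misere_moves coin_identified N t) (possibilities N)"

end

theory Submission
  imports Defs
begin

text \<open>
  From the initial position \<open>possibilities N\<close>, only two kinds of positions arise. As long as all
  weighings balance, the position is \<open>X \<times> UNIV\<close>: the coins in \<open>X\<close> are unknown and all others are
  real. After the first unbalanced weighing every remaining coin has a destiny, so the position \<open>S\<close>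
  satisfies \<open>inj_on fst S\<close>, and on such positions finding and identifying the coin are the same
  goal, namely \<open>card S = 1\<close>.

  Suppose that at least one coin is already known to be real. It can fill up a pan, so that parity is
  no obstacle. From a destined position \<open>S\<close> one can then move to every proper subset containing the
  truth \<open>t\<close>; hence its value is \<open>card S - 1\<close> in normal play and \<open>card S - 2\<close> in misere play
  (\<open>grundy_normal_destined\<close>, \<open>grundy_misere_destined\<close>). From \<open>X \<times> UNIV\<close> one can move to destined
  positions of all sizes from \<open>1\<close> to \<open>card X\<close>, and otherwise only to \<open>Y \<times> UNIV\<close> with \<open>Y \<subset> X\<close>; so,
  unless the goal is reached, the value is \<open>card X\<close> in normal play and \<open>card X - 1\<close> in misere play
  (\<open>grundy_normal_unknown\<close>, \<open>grundy_misere_unknown\<close>).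

  In the initial position no coin is known to be real. As \<open>N\<close> is even, every move leads to an even
  number of unknown coins or to an even number of destined ones. In normal play all these
  options have a positive value, so the initial value is \<open>0\<close>. In misere play the destined options of
  sizes \<open>2, 4, \<dots>, N - 2\<close> have the values \<open>0, 2, \<dots>, N - 4\<close> and the unknown ones
  \<open>1, 3, \<dots>, N - 3\<close>, so the initial value is \<open>N - 2\<close> unless this is the value of the one
  remaining kind of option: all \<open>N\<close> coins on the scale. There the two destinies are equally
  frequent. Hence one can finish from it by comparing two coins of the same destiny, which makes
  its normal value positive; and no weighing excludes exactly one coin (\<open>no_single_exclusion\<close>),
  so that its misere value is at most \<open>N - 3\<close>.
\<close>

section \<open>Minimal excludants and weighings\<close>

lemma mex_eqI:
  assumes "n \<notin> A" and "{..<n} \<subseteq> A"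
  shows "mex A = n"
  unfolding mex_def
proof (rule Least_equality)
  show "n \<le> m" if "m \<notin> A" for m
    using that assms(2) by (meson lessThan_iff not_less subsetD)
qed (rule assms(1))

lemma mex_le:
  assumes "n \<notin> A"
  shows "mex A \<le> n"
  unfolding mex_def using assms by (rule Least_le)

lemma mex_empty: "mex {} = 0"
  by (rule mex_eqI) auto

lemma mex_notin:
  assumes "finite A"
  shows "mex A \<notin> A"
proof -
  have "\<exists>n. n \<notin> A" using assms by (rule ex_new_if_finite [OF infinite_UNIV_nat])
  then show ?thesis unfolding mex_def by (rule LeastI_ex)
qed

lemma finite_possibilities: "finite (possibilities N)"
proof -
  have "(UNIV :: bias set) = {Lighter, Heavier}"
    using bias.exhaust by auto
  then have "finite (UNIV :: bias set)"
    by (metis finite.emptyI finite.insertI)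
  then show ?thesis by (simp add: possibilities_def)
qed

text \<open>\<open>dev b\<close> is the deviation of a counterfeit coin of bias \<open>b\<close> from the weight of a real coin.\<close>

definition dev :: "bias \<Rightarrow> int" where
  "dev b = (case b of Lighter \<Rightarrow> - 1 | Heavier \<Rightarrow> 1)"

lemma dev_neq_0: "dev b \<noteq> 0"
  by (cases b) (simp_all add: dev_def)

lemma dev_sign: "dev b = 1 \<or> dev b = - 1"
  by (cases b) (simp_all add: dev_def)

lemma dev_eq_iff: "dev b = dev b' \<longleftrightarrow> b = b'"
  by (cases b; cases b') (simp_all add: dev_def)

lemma dev_surj: "z = 1 \<or> z = - 1 \<Longrightarrow> \<exists>b. dev b = z"
  by (metis bias.simps(3,4) dev_def)

lemma weighing_outcome:
  assumes "weighing N A B"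
  shows "outcome A B p =
    (if fst p \<in> A then dev (snd p) else if fst p \<in> B then - dev (snd p) else 0)"
proof -
  have fin: "finite A" "finite B" and dis: "A \<inter> B = {}"
    using assms finite_subset[OF _ finite_lessThan] by (auto simp: weighing_def)
  have "(\<Sum>x\<in>C. rel_weight p x) = (if fst p \<in> C then dev (snd p) else 0)" if "finite C" for C
    unfolding rel_weight_def dev_def by (simp add: that)
  with fin dis show ?thesis
    using dev_sign[of "snd p"] by (auto simp: outcome_def)
qed

lemma weighing_even:
  assumes "weighing N A B"
  shows "A \<union> B \<subseteq> {..<N}" and "even (card (A \<union> B))"
proof -
  have fin: "finite A" "finite B"
    using assms finite_subset[OF _ finite_lessThan] by (auto simp: weighing_def)
  show "A \<union> B \<subseteq> {..<N}" using assms by (simp add: weighing_def)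
  show "even (card (A \<union> B))"
    using assms fin by (simp add: weighing_def card_Un_disjoint)
qed

lemma even_split:
  assumes "W \<subseteq> {..<N}" and "even (card W)"
  obtains A B where "weighing N A B" and "A \<union> B = W"
proof -
  have fin: "finite W" using assms(1) finite_subset by blast
  obtain A where A: "A \<subseteq> W" "card A = card W div 2"
    using obtain_subset_with_card_n[of "card W div 2" W] by auto
  have "card (W - A) = card A"
    using A assms(2) fin by (auto simp: card_Diff_subset finite_subset elim!: evenE)
  then have "weighing N A (W - A)"
    using A assms(1) by (auto simp: weighing_def)
  with A show ?thesis by (intro that[of A "W - A"]) auto
qed

text \<open>
  If the coins outside \<open>Y\<close> are known to be real and there is at least one of them, any set \<open>V\<close>
  of coins in \<open>Y\<close> can be put on the scale, with a real coin added when \<open>card V\<close> is odd.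
\<close>

lemma even_filling:
  fixes N :: nat
  assumes "V \<subseteq> Y" and "Y \<subset> {..<N}"
  obtains W where "W \<subseteq> {..<N}" and "even (card W)" and "Y \<inter> W = V"
proof -
  obtain x where x: "x < N" "x \<notin> Y" using assms(2) by auto
  have sub: "V \<subseteq> {..<N}" using assms by auto
  then have fin: "finite V" by (rule finite_subset) simp
  show ?thesis
  proof (cases "even (card V)")
    case True
    then show ?thesis using that[of V] sub assms(1) by (simp add: Int_absorb1)
  next
    case False
    moreover have "x \<notin> V" using x assms(1) by auto
    ultimately have "even (card (insert x V))" using fin by simp
    then show ?thesis
      using that[of "insert x V"] sub assms(1) x by (simp add: Int_absorb1)
  qed
qed

lemma balanced_move:
  assumes "W \<subseteq> {..<N}" and "even (card W)" and "fst t \<notin> W" and "{p \<in> S. fst p \<notin> W} \<noteq> S"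
  shows "{p \<in> S. fst p \<notin> W} \<in> moves N t S"
proof -
  obtain A B where AB: "weighing N A B" "A \<union> B = W"
    using even_split[OF assms(1,2)] .
  have "outcome A B p = outcome A B t \<longleftrightarrow> fst p \<notin> W" for p
    using assms(3) AB(2) by (auto simp: weighing_outcome[OF AB(1)] dev_neq_0)
  then have "{p \<in> S. fst p \<notin> W} = {p \<in> S. outcome A B p = outcome A B t}" by simp
  then show ?thesis using AB(1) assms(4) unfolding moves_def by blast
qed

lemma truth_in_move: "t \<in> S \<Longrightarrow> S' \<in> moves N t S \<Longrightarrow> t \<in> S'"
  by (auto simp: moves_def)

lemma move_subset: "S' \<in> moves N t S \<Longrightarrow> S' \<subset> S"
  by (simp add: moves_def)

lemma unbalanced_outcome:
  fixes X :: "nat set"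
  assumes "weighing N A B" and "z = 1 \<or> z = - 1"
  defines "S \<equiv> {p \<in> X \<times> UNIV. outcome A B p = z}"
  shows "inj_on fst S" and "fst ` S = X \<inter> (A \<union> B)"
proof -
  show "inj_on fst S"
    using assms(2) by (auto simp: inj_on_def S_def weighing_outcome[OF assms(1)] dev_eq_iff[symmetric]
        split: if_splits)
  have "\<exists>b. (x, b) \<in> S" if x: "x \<in> X" "x \<in> A \<union> B" for x
  proof (cases "x \<in> A")
    case True
    then show ?thesis
      using x dev_surj[OF assms(2)] by (auto simp: S_def weighing_outcome[OF assms(1)])
  next
    case False
    obtain b where "dev b = - z" using dev_surj[of "- z"] assms(2) by auto
    then have "(x, b) \<in> S"
      using x False by (simp add: S_def weighing_outcome[OF assms(1)])
    then show ?thesis ..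
  qed
  then show "fst ` S = X \<inter> (A \<union> B)"
    using assms(2) by (force simp: S_def weighing_outcome[OF assms(1)] split: if_splits)
qed

section \<open>Moves from unknown and from destined positions\<close>

text \<open>
  With a real coin at hand, the coins of any set not containing the counterfeit one can be shown
  to be real by a single balanced weighing.
\<close>

lemma moves_destined:
  assumes "inj_on fst S" and "t \<in> S" and "fst ` S \<subset> {..<N}"
  shows "moves N t S = {T. t \<in> T \<and> T \<subset> S}"
proof (intro equalityI subsetI)
  fix T assume "T \<in> moves N t S"
  then show "T \<in> {T. t \<in> T \<and> T \<subset> S}"
    using truth_in_move[OF assms(2)] move_subset by blast
next
  fix T assume "T \<in> {T. t \<in> T \<and> T \<subset> S}"
  then have T: "t \<in> T" "T \<subset> S" by auto
  have "fst ` (S - T) \<subseteq> fst ` S" by auto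
  then obtain W where W: "W \<subseteq> {..<N}" "even (card W)" "fst ` S \<inter> W = fst ` (S - T)"
    using even_filling[OF _ assms(3)] by metis
  have "fst p \<in> W \<longleftrightarrow> p \<notin> T" if "p \<in> S" for p
  proof -
    have "fst p \<in> W \<longleftrightarrow> fst p \<in> fst ` (S - T)" using W(3) that by blast
    also have "\<dots> \<longleftrightarrow> p \<notin> T"
      using inj_on_image_mem_iff[OF assms(1) that, of "S - T"] that by auto
    finally show ?thesis .
  qed
  then have "{p \<in> S. fst p \<notin> W} = T" and "fst t \<notin> W" using T assms(2) by auto
  then show "T \<in> moves N t S"
    using balanced_move[OF W(1,2), of t S] T by auto
qed

lemma moves_unknown_cases:
  assumes "S' \<in> moves N t (X \<times> UNIV)"
  obtains W where "W \<subseteq> {..<N}" and "even (card W)" and "fst t \<notin> W" and "X - W \<subset> X"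
      and "S' = (X - W) \<times> UNIV"
  | A B where "weighing N A B" and "fst t \<in> A \<union> B" and "inj_on fst S'"
      and "fst ` S' = X \<inter> (A \<union> B)"
      and "S' = {p \<in> X \<times> UNIV. outcome A B p = outcome A B t}"
proof -
  obtain A B where AB: "weighing N A B"
    and S': "S' = {p \<in> X \<times> UNIV. outcome A B p = outcome A B t}" and sub: "S' \<subset> X \<times> UNIV"
    using assms by (auto simp: moves_def)
  show ?thesis
  proof (cases "fst t \<in> A \<union> B")
    case True
    then have "outcome A B t = 1 \<or> outcome A B t = - 1"
      using dev_sign[of "snd t"] by (auto simp: weighing_outcome[OF AB])
    note unbalanced_outcome[OF AB this, of X]
    then show ?thesis using that(2)[OF AB True] S' by blast
  next
    case False
    then have eq: "S' = (X - (A \<union> B)) \<times> UNIV"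
      by (auto simp: S' weighing_outcome[OF AB] dev_neq_0)
    moreover have "X - (A \<union> B) \<subset> X" using sub eq by auto
    ultimately show ?thesis using that(1)[of "A \<union> B"] False weighing_even[OF AB] by blast
  qed
qed

lemma unknown_to_unknown:
  assumes "W \<subseteq> {..<N}" and "even (card W)" and "fst t \<notin> W" and "X - W \<subset> X"
  shows "(X - W) \<times> UNIV \<in> moves N t (X \<times> UNIV)"
proof -
  have "{p \<in> X \<times> UNIV. fst p \<notin> W} = (X - W) \<times> (UNIV :: bias set)" by auto
  moreover have "(X - W) \<times> (UNIV :: bias set) \<noteq> X \<times> UNIV" using assms(4) by auto
  ultimately show ?thesis using balanced_move[OF assms(1-3), of "X \<times> UNIV"] by metis
qed

lemma unknown_to_destined:
  assumes "W \<subseteq> {..<N}" and "even (card W)" and "fst t \<in> X \<inter> W"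
  obtains S' where "S' \<in> moves N t (X \<times> UNIV)" and "inj_on fst S'" and "fst ` S' = X \<inter> W"
proof -
  obtain A B where AB: "weighing N A B" "A \<union> B = W"
    using even_split[OF assms(1,2)] .
  define S' where "S' = {p \<in> X \<times> UNIV. outcome A B p = outcome A B t}"
  have "outcome A B t = 1 \<or> outcome A B t = - 1"
    using dev_sign[of "snd t"] AB(2) assms(3) by (auto simp: weighing_outcome[OF AB(1)])
  note S' = unbalanced_outcome[OF AB(1) this, of X, folded S'_def]
  have "\<not> inj_on fst (X \<times> (UNIV :: bias set))"
    using assms(3) unfolding inj_on_def by (metis IntD1 SigmaI UNIV_I bias.distinct(1) fst_conv snd_conv)
  with S'(1) have "S' \<noteq> X \<times> UNIV" by auto
  then have "S' \<in> moves N t (X \<times> UNIV)" using AB(1) unfolding moves_def S'_def by blast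
  with S' AB(2) show ?thesis using that by blast
qed

text \<open>
  If all coins are on the scale in the first weighing, equally many of them become destined to be
  lighter and to be heavier. A later balanced weighing then excludes an even number of coins. An
  unbalanced one that excluded exactly one coin would again have all coins on the scale, as their
  number is even. Turning over the destiny of the excluded coin would make all destinies consistent
  with the outcome and hence equally frequent, so before that the frequencies differed by two.
\<close>

lemma no_single_exclusion:
  assumes AB: "weighing N A B" "A \<union> B = {..<N}"
    and S: "S = {p \<in> possibilities N. outcome A B p = outcome A B t}"
    and t: "t \<in> S"
    and T: "T \<in> moves N t S"
  shows "card T + 1 \<noteq> N"
proof -
  obtain C D where CD: "weighing N C D" and T_eq: "T = {p \<in> S. outcome C D p = outcome C D t}"
    using T by (auto simp: moves_def)
  have fin: "finite A" "finite B" "finite C" "finite D"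
    using AB CD finite_subset[OF _ finite_lessThan] by (auto simp: weighing_def)
  have tN: "fst t < N" using t S by (auto simp: possibilities_def)
  have S': "S = {p \<in> {..<N} \<times> UNIV. outcome A B p = outcome A B t}"
    using S by (simp add: possibilities_def)
  have zt: "outcome A B t = 1 \<or> outcome A B t = - 1"
    using tN AB(2) dev_sign[of "snd t"] by (auto simp: weighing_outcome[OF AB(1)])
  note inj = unbalanced_outcome(1)[OF AB(1) zt, of "{..<N}", folded S']
  have fstS: "fst ` S = {..<N}"
    using unbalanced_outcome(2)[OF AB(1) zt, of "{..<N}", folded S'] AB(2) by auto
  have card_T: "card T = card (fst ` T)"
    using inj T_eq by (intro card_image[symmetric]) (auto simp: inj_on_def)
  have N: "N = card A + card B"
    using AB fin by (metis card_Un_disjoint card_lessThan weighing_def)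
  show ?thesis
  proof (cases "fst t \<in> C \<union> D")
    case False
    have "T = {p \<in> S. fst p \<notin> C \<union> D}"
      using False by (auto simp: T_eq weighing_outcome[OF CD] dev_neq_0)
    then have "fst ` T = fst ` S - (C \<union> D)" by auto
    then have "fst ` T = {..<N} - (C \<union> D)" by (simp only: fstS)
    then have "card T = N - card (C \<union> D)"
      using card_T weighing_even[OF CD] fin by (simp add: card_Diff_subset)
    moreover have "card (C \<union> D) \<le> N"
      using card_mono[OF _ weighing_even(1)[OF CD]] by simp
    moreover have "even N" using N AB by (simp add: weighing_def)
    ultimately show ?thesis using weighing_even(2)[OF CD] by presburger
  next
    case True
    \<comment> \<open>The pans \<open>C\<close> and \<open>D\<close> are swapped, if necessary, so that both weighings have the same
      outcome for \<open>t\<close>.\<close>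
    obtain C' D' where CD': "weighing N C' D'" "C' \<union> D' = C \<union> D"
      and T': "T = {p \<in> S. outcome C' D' p = outcome A B t}"
    proof (cases "outcome C D t = outcome A B t")
      case eq: True
      then show ?thesis using that[OF CD] T_eq by simp
    next
      case False
      have DC: "weighing N D C" using CD by (auto simp: weighing_def)
      have swap: "outcome D C p = - outcome C D p" for p
        using CD by (auto simp: weighing_outcome[OF CD] weighing_outcome[OF DC] weighing_def)
      have "outcome C D t = - outcome A B t"
        using False zt True dev_sign[of "snd t"] by (auto simp: weighing_outcome[OF CD])
      then have "T = {p \<in> S. outcome D C p = outcome A B t}"
        unfolding T_eq swap by auto
      then show ?thesis using that[OF DC] by blast
    qed
    have disj: "A \<inter> B = {}" "C' \<inter> D' = {}" "C' \<union> D' \<subseteq> A \<union> B" "card A = card B" "card C' = card D'"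
      using AB CD' by (auto simp: weighing_def)
    have fin': "finite C'" "finite D'" using CD' fin by (metis finite_Un)+
    have "fst ` T = (A \<inter> C') \<union> (B \<inter> D')"
    proof (intro equalityI subsetI)
      fix x assume "x \<in> fst ` T"
      then show "x \<in> (A \<inter> C') \<union> (B \<inter> D')"
        using zt AB(2) disj by (auto simp: T' S' weighing_outcome[OF AB(1)]
            weighing_outcome[OF CD'(1)] dev_neq_0 split: if_splits)
    next
      fix x assume x: "x \<in> (A \<inter> C') \<union> (B \<inter> D')"
      then have "x \<in> fst ` S" using fstS AB(2) by auto
      then obtain p where p: "p \<in> S" "x = fst p" by auto
      have "outcome C' D' p = outcome A B p"
        using x disj(1,2) unfolding p(2) weighing_outcome[OF AB(1)] weighing_outcome[OF CD'(1)]
        by auto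
      with p(1) have "p \<in> T" by (simp add: T' S')
      with p show "x \<in> fst ` T" by auto
    qed
    then have 1: "card T = card (A \<inter> C') + card (B \<inter> D')"
      unfolding card_T using fin disj by (simp add: card_Un_disjoint disjoint_iff)
    have 2: "card (P \<inter> C') + card (P \<inter> D') \<le> card P" if "finite P" for P
    proof -
      have "card (P \<inter> C') + card (P \<inter> D') = card ((P \<inter> C') \<union> (P \<inter> D'))"
        using that disj(2) by (intro card_Un_disjoint[symmetric]) auto
      also have "\<dots> \<le> card P" using that by (intro card_mono) auto
      finally show ?thesis .
    qed
    have "C' = (A \<inter> C') \<union> (B \<inter> C')" "D' = (A \<inter> D') \<union> (B \<inter> D')" using disj by auto
    then have 3: "card C' = card (A \<inter> C') + card (B \<inter> C')"
        "card D' = card (A \<inter> D') + card (B \<inter> D')"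
      using fin disj by (metis card_Un_disjoint finite_Int inf_assoc inf_commute inf_bot_left)+
    show ?thesis
    proof
      assume "card T + 1 = N"
      then have "card (A \<inter> C') = card A \<or> card (B \<inter> D') = card B"
        using 1 2[OF fin(1)] 2[OF fin(2)] disj(4) N by linarith
      then show False
        using \<open>card T + 1 = N\<close> 1 2[OF fin(1)] 2[OF fin(2)] 3 disj(4,5) N by linarith
    qed
  qed
qed

text \<open>
  When all coins, at least four of them, are on the scale in the first weighing, the counterfeit
  coin can next be compared with another one of the same destiny, which reveals the truth.
\<close>

lemma compare_same_destiny:
  assumes AB: "weighing N A B" "A \<union> B = {..<N}"
    and S: "S = {p \<in> possibilities N. outcome A B p = outcome A B t}"
    and t: "t \<in> S" and N: "N \<ge> 4"
  shows "{t} \<in> moves N t S"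
proof -
  have fin: "finite A" "finite B"
    using AB finite_subset[OF _ finite_lessThan] by (auto simp: weighing_def)
  have dis: "A \<inter> B = {}" using AB by (simp add: weighing_def)
  have "card A + card B = N"
    using AB fin dis by (metis card_Un_disjoint card_lessThan)
  then have ge2: "card A \<ge> 2" "card B \<ge> 2"
    using AB N by (auto simp: weighing_def)
  have other: "\<exists>x\<in>P. x \<noteq> y" if "card P \<ge> 2" for P :: "nat set" and y
  proof (rule ccontr)
    assume "\<not> ?thesis"
    then have "P \<subseteq> {y}" by auto
    then have "card P \<le> card {y}" by (intro card_mono) auto
    with that show False by simp
  qed
  have tN: "fst t \<in> A \<union> B" using t unfolding AB(2) S by (auto simp: possibilities_def)
  obtain x where x: "x \<in> A \<union> B" "x \<noteq> fst t" "x \<in> A \<longleftrightarrow> fst t \<in> A"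
  proof (cases "fst t \<in> A")
    case True
    then show ?thesis using that other[OF ge2(1), of "fst t"] by auto
  next
    case False
    then show ?thesis using that other[OF ge2(2), of "fst t"] dis by auto
  qed
  have CD: "weighing N {fst t} {x}"
    using x tN AB by (auto simp: weighing_def)
  have "p = t \<longleftrightarrow> outcome {fst t} {x} p = outcome {fst t} {x} t" if p: "p \<in> S" for p
  proof
    assume eq: "outcome {fst t} {x} p = outcome {fst t} {x} t"
    have same: "outcome A B p = outcome A B t" using p S by simp
    consider "fst p = fst t" | "fst p = x" | "fst p \<noteq> fst t" "fst p \<noteq> x" by blast
    then show "p = t"
    proof cases
      case 1
      then show ?thesis
        using eq by (simp add: weighing_outcome[OF CD] dev_eq_iff prod_eq_iff)
    next
      case 2
      then have "dev (snd p) = dev (snd t)"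
        using same x tN dis by (auto simp: weighing_outcome[OF AB(1)] split: if_splits)
      then show ?thesis
        using eq 2 x(2) dev_neq_0[of "snd t"] by (simp add: weighing_outcome[OF CD])
    next
      case 3
      then show ?thesis using eq dev_neq_0[of "snd t"] by (simp add: weighing_outcome[OF CD])
    qed
  qed simp
  then have "{t} = {p \<in> S. outcome {fst t} {x} p = outcome {fst t} {x} t}"
    using t by blast
  moreover have "{t} \<noteq> S"
  proof
    assume "{t} = S"
    moreover have "outcome A B (x, snd t) = outcome A B t"
      using x tN dis by (auto simp: weighing_outcome[OF AB(1)])
    then have "(x, snd t) \<in> S" using x(1) AB(2) by (auto simp: S possibilities_def)
    ultimately have "(x, snd t) = t" by blast
    then show False using x(2) by (metis fst_conv)
  qed
  ultimately show ?thesis using CD t unfolding moves_def by blast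
qed

text \<open>
  Positions after an unbalanced weighing in which some coin is already known to be real: each
  remaining coin is possible with one bias only, and the remaining coins are not all coins.
\<close>

definition destined :: "nat \<Rightarrow> possibility \<Rightarrow> possibility set \<Rightarrow> bool" where
  "destined N t S \<longleftrightarrow> inj_on fst S \<and> t \<in> S \<and> fst ` S \<subset> {..<N}"

lemma destined_finite: "destined N t S \<Longrightarrow> finite S"
  unfolding destined_def
  by (metis finite_imageD finite_lessThan finite_subset psubset_imp_subset)

lemma destined_card_pos:
  assumes "destined N t S"
  shows "card S \<ge> 1"
  using assms destined_finite[OF assms] by (auto simp: destined_def Suc_le_eq card_gt_0_iff)

lemma destined_subset: "destined N t S \<Longrightarrow> T \<subseteq> S \<Longrightarrow> t \<in> T \<Longrightarrow> destined N t T"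
  unfolding destined_def using inj_on_subset by blast

lemma destined_card_lt:
  assumes "destined N t S"
  shows "card S < N"
proof -
  have "card S = card (fst ` S)" using assms by (simp add: destined_def card_image)
  also have "\<dots> < card {..<N}" using assms by (intro psubset_card_mono) (auto simp: destined_def)
  finally show ?thesis by simp
qed

lemma subset_with_member:
  assumes "finite S" and "t \<in> S" and "1 \<le> n" and "n \<le> card S"
  obtains T where "t \<in> T" and "T \<subseteq> S" and "card T = n"
  using exists_subset_between[of "{t}" n S] assms by auto

lemma destined_move_of_size:
  assumes "destined N t S" and "1 \<le> n" and "n < card S"
  obtains T where "T \<in> moves N t S" and "destined N t T" and "card T = n"
proof -
  have t: "t \<in> S" using assms(1) by (simp add: destined_def)
  obtain T where T: "t \<in> T" "T \<subseteq> S" "card T = n"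
    using subset_with_member[OF destined_finite[OF assms(1)] t assms(2)] assms(3) by auto
  moreover have "T \<in> moves N t S"
    using T assms by (subst moves_destined) (auto simp: destined_def)
  ultimately show ?thesis using that destined_subset[OF assms(1)] by blast
qed

lemma destined_move:
  assumes "destined N t S" and "T \<in> moves N t S"
  shows "destined N t T" and "card T < card S"
proof -
  have "T \<subset> S" "t \<in> T"
    using move_subset[OF assms(2)] truth_in_move[OF _ assms(2)] assms(1)
    by (auto simp: destined_def)
  then show "destined N t T" "card T < card S"
    using destined_subset[OF assms(1)] psubset_card_mono[OF destined_finite[OF assms(1)]] by auto
qed

text \<open>
  The next two lemmas bound the options of a position with unknown and with real coins: a
  destined option is never larger than the number of unknown coins, and all these sizes occur.
\<close>

lemma unknown_move:
  assumes "X \<subset> {..<N}" and "fst t \<in> X" and "S' \<in> moves N t (X \<times> UNIV)"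
  obtains Y where "Y \<subset> X" and "fst t \<in> Y" and "S' = Y \<times> UNIV"
  | "destined N t S'" and "card S' \<le> card X"
proof -
  have t: "t \<in> S'" using truth_in_move[OF _ assms(3)] assms(2) by (simp add: mem_Times_iff)
  have fin: "finite X" using assms(1) finite_subset by blast
  from assms(3) show ?thesis
  proof (cases rule: moves_unknown_cases)
    case (1 W)
    then show ?thesis using that(1)[of "X - W"] assms(2) by blast
  next
    case (2 A B)
    then have "card S' = card (X \<inter> (A \<union> B))" by (metis card_image)
    then have "card S' \<le> card X" using fin by (simp add: card_mono)
    moreover have "destined N t S'" using 2 t assms(1) by (auto simp: destined_def)
    ultimately show ?thesis using that(2) by blast
  qed
qed

lemma unknown_move_of_size:
  assumes "X \<subset> {..<N}" and "fst t \<in> X" and "1 \<le> n" and "n \<le> card X"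
  obtains S' where "S' \<in> moves N t (X \<times> UNIV)" and "destined N t S'" and "card S' = n"
proof -
  have "finite X" using assms(1) finite_subset by blast
  then obtain V where V: "fst t \<in> V" "V \<subseteq> X" "card V = n"
    using subset_with_member assms by metis
  obtain W where W: "W \<subseteq> {..<N}" "even (card W)" "X \<inter> W = V"
    using even_filling[OF V(2) assms(1)] .
  then obtain S' where S': "S' \<in> moves N t (X \<times> UNIV)" "inj_on fst S'" "fst ` S' = V"
    using unknown_to_destined[of W N t X] V(1) by metis
  have "t \<in> S'" using truth_in_move[OF _ S'(1)] assms(2) by (simp add: mem_Times_iff)
  then have "destined N t S'" using S' V(2) assms(1) by (auto simp: destined_def)
  moreover have "card S' = n" using S' V(3) by (metis card_image)
  ultimately show ?thesis using that S'(1) by blast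
qed

section \<open>Grundy values when a real coin is known\<close>

text \<open>
  The common properties of the two goals, finding the coin and identifying it. The goals differ
  only when a single unknown coin is left, and there the locale leaves the goal open.
\<close>

locale coin_goal =
  fixes goal :: "possibility set \<Rightarrow> bool"
  assumes goal_inj: "inj_on fst S \<Longrightarrow> goal S \<longleftrightarrow> card S = 1"
    and goal_unknown: "goal (X \<times> UNIV) \<Longrightarrow> card X = 1"
begin

lemma goal_destined: "destined N t S \<Longrightarrow> goal S \<longleftrightarrow> card S = 1"
  by (simp add: destined_def goal_inj)

lemma grundy_normal_destined:
  assumes "destined N t S"
  shows "grundy (normal_moves goal N t) S = card S - 1"
  using assms
proof (induction "card S" arbitrary: S rule: less_induct)
  case less
  let ?G = "grundy (normal_moves goal N t)"
  show ?case
  proof (cases "card S = 1")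
    case True
    then show ?thesis
      by (simp add: grundy_normal_rec[of goal N t S] normal_moves_def goal_destined[OF less.prems]
          mex_empty)
  next
    case False
    then have opts: "normal_moves goal N t S = moves N t S"
      by (simp add: normal_moves_def goal_destined[OF less.prems])
    have G: "?G T = card T - 1" "1 \<le> card T" "card T < card S" if "T \<in> moves N t S" for T
      using less.hyps destined_move[OF less.prems that] destined_card_pos by blast+
    show ?thesis unfolding grundy_normal_rec[of goal N t S] opts
    proof (rule mex_eqI)
      show "card S - 1 \<notin> ?G ` moves N t S" using G by fastforce
    next
      show "{..<card S - 1} \<subseteq> ?G ` moves N t S"
      proof
        fix n assume "n \<in> {..<card S - 1}"
        then have n: "1 \<le> Suc n" "Suc n < card S" by auto
        obtain T where "T \<in> moves N t S" "destined N t T" "card T = Suc n"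
          using destined_move_of_size[OF less.prems n] .
        then show "n \<in> ?G ` moves N t S" using G(1)[of T] by (intro image_eqI[of _ _ T]) auto
      qed
    qed
  qed
qed

lemma grundy_misere_destined:
  assumes "destined N t S"
  shows "grundy (misere_moves goal N t) S = card S - 2"
  using assms
proof (induction "card S" arbitrary: S rule: less_induct)
  case less
  let ?G = "grundy (misere_moves goal N t)"
  have opts: "misere_moves goal N t S = {T \<in> moves N t S. 2 \<le> card T}"
  proof -
    have "\<not> goal T \<longleftrightarrow> 2 \<le> card T" if "T \<in> moves N t S" for T
      using goal_destined[OF destined_move(1)[OF less.prems that]]
        destined_card_pos[OF destined_move(1)[OF less.prems that]] by auto
    moreover have "card S \<noteq> 1" if "T \<in> moves N t S" for T
      using destined_move[OF less.prems that] destined_card_pos[of N t T] by simp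
    ultimately show ?thesis
      by (auto simp: misere_moves_def normal_moves_def goal_destined[OF less.prems])
  qed
  have G: "?G T = card T - 2" "card T < card S" if "T \<in> moves N t S" for T
    using less.hyps destined_move[OF less.prems that] by blast+
  show ?case unfolding grundy_misere_rec[of goal N t S] opts
  proof (rule mex_eqI)
    show "card S - 2 \<notin> ?G ` {T \<in> moves N t S. 2 \<le> card T}" using G by fastforce
  next
    show "{..<card S - 2} \<subseteq> ?G ` {T \<in> moves N t S. 2 \<le> card T}"
    proof
      fix n assume "n \<in> {..<card S - 2}"
      then have n: "1 \<le> n + 2" "n + 2 < card S" by auto
      obtain T where "T \<in> moves N t S" "destined N t T" "card T = n + 2"
        using destined_move_of_size[OF less.prems n] .
      then show "n \<in> ?G ` {T \<in> moves N t S. 2 \<le> card T}"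
        using G(1)[of T] by (intro image_eqI[of _ _ T]) auto
    qed
  qed
qed

lemma grundy_normal_unknown:
  assumes "X \<subset> {..<N}" and "fst t \<in> X"
  shows "grundy (normal_moves goal N t) (X \<times> UNIV) = (if goal (X \<times> UNIV) then 0 else card X)"
  using assms
proof (induction "card X" arbitrary: X rule: less_induct)
  case less
  let ?G = "grundy (normal_moves goal N t)" and ?S = "X \<times> (UNIV :: bias set)"
  have fin: "finite X" using less.prems(1) finite_subset by blast
  show ?case
  proof (cases "goal ?S")
    case True
    then show ?thesis by (simp add: grundy_normal_rec[of goal N t ?S] normal_moves_def mex_empty)
  next
    case False
    then have opts: "normal_moves goal N t ?S = moves N t ?S" by (simp add: normal_moves_def)
    have "?G ?S = card X"
      unfolding grundy_normal_rec[of goal N t ?S] opts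
    proof (rule mex_eqI)
      have "?G T < card X" if "T \<in> moves N t ?S" for T
        using less.prems that
      proof (cases rule: unknown_move)
        case (1 Y)
        then have "card Y < card X" using fin by (simp add: psubset_card_mono)
        moreover have "?G T = (if goal (Y \<times> UNIV) then 0 else card Y)"
          using less.hyps[OF \<open>card Y < card X\<close>] 1 less.prems(1) by auto
        ultimately show ?thesis by (auto split: if_splits)
      next
        case 2
        then show ?thesis
          using grundy_normal_destined[OF 2(1)] destined_card_pos[OF 2(1)] by simp
      qed
      then have "\<forall>T\<in>moves N t ?S. card X \<noteq> ?G T" by (simp add: neq_iff)
      then show "card X \<notin> ?G ` moves N t ?S" by blast
    next
      show "{..<card X} \<subseteq> ?G ` moves N t ?S"
      proof
        fix n assume "n \<in> {..<card X}"
        then have n: "1 \<le> Suc n" "Suc n \<le> card X" by auto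
        obtain T where "T \<in> moves N t ?S" "destined N t T" "card T = Suc n"
          using unknown_move_of_size[OF less.prems n] .
        then show "n \<in> ?G ` moves N t ?S"
          using grundy_normal_destined[of N t T] by (intro image_eqI[of _ _ T]) auto
      qed
    qed
    with False show ?thesis by simp
  qed
qed

lemma grundy_misere_unknown:
  assumes "X \<subset> {..<N}" and "fst t \<in> X"
  shows "grundy (misere_moves goal N t) (X \<times> UNIV) = card X - 1"
  using assms
proof (induction "card X" arbitrary: X rule: less_induct)
  case less
  let ?G = "grundy (misere_moves goal N t)" and ?S = "X \<times> (UNIV :: bias set)"
  have fin: "finite X" using less.prems(1) finite_subset by blast
  show ?case unfolding grundy_misere_rec[of goal N t ?S]
  proof (rule mex_eqI)
    have "?G T < card X - 1" if T: "T \<in> misere_moves goal N t ?S" for T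
    proof -
      have "T \<in> moves N t ?S" "\<not> goal T"
        using T by (auto simp: misere_moves_def normal_moves_def split: if_splits)
      from less.prems this(1) show ?thesis
      proof (cases rule: unknown_move)
        case (1 Y)
        then have lt: "card Y < card X" using fin by (simp add: psubset_card_mono)
        moreover have "?G T = card Y - 1"
          using less.hyps[OF lt] 1 less.prems(1) by auto
        moreover have "card Y \<ge> 1"
          using 1 fin by (metis One_nat_def Suc_leI card_gt_0_iff empty_iff finite_subset psubset_imp_subset)
        ultimately show ?thesis by auto
      next
        case 2
        then have "card T \<ge> 2"
          using goal_destined[OF 2(1)] destined_card_pos[OF 2(1)] \<open>\<not> goal T\<close> by simp
        then show ?thesis using grundy_misere_destined[OF 2(1)] 2(2) by simp
      qed
    qed
    then have "\<forall>T\<in>misere_moves goal N t ?S. card X - 1 \<noteq> ?G T"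
      by (simp add: neq_iff)
    then show "card X - 1 \<notin> ?G ` misere_moves goal N t ?S" by blast
  next
    show "{..<card X - 1} \<subseteq> ?G ` misere_moves goal N t ?S"
    proof
      fix n assume "n \<in> {..<card X - 1}"
      then have n: "1 \<le> n + 2" "n + 2 \<le> card X" by auto
      obtain T where T: "T \<in> moves N t ?S" "destined N t T" "card T = n + 2"
        using unknown_move_of_size[OF less.prems n] .
      have "\<not> goal ?S" using goal_unknown[of X] n by auto
      then have "T \<in> misere_moves goal N t ?S"
        using T goal_destined[OF T(2)] by (simp add: misere_moves_def normal_moves_def)
      then show "n \<in> ?G ` misere_moves goal N t ?S"
        using grundy_misere_destined[OF T(2)] T(3) by (intro image_eqI[of _ _ T]) auto
    qed
  qed
qed

end

section \<open>The initial position\<close>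

lemma initial_move:
  assumes "even N" and "t \<in> possibilities N" and "S \<in> moves N t (possibilities N)"
  obtains Y where "Y \<subset> {..<N}" and "fst t \<in> Y" and "even (card Y)" and "S = Y \<times> UNIV"
  | "destined N t S" and "even (card S)"
  | A B where "weighing N A B" and "A \<union> B = {..<N}" and "inj_on fst S"
      and "S = {p \<in> possibilities N. outcome A B p = outcome A B t}"
proof -
  have t: "t \<in> S" using assms(2,3) by (rule truth_in_move)
  from assms(3)[unfolded possibilities_def] show ?thesis
  proof (cases rule: moves_unknown_cases)
    case (1 W)
    have "card ({..<N} - W) = N - card W" "card W \<le> N"
      using finite_subset[OF 1(1)] card_mono[OF finite_lessThan 1(1)] 1(1)
      by (auto simp: card_Diff_subset)
    then have "even (card ({..<N} - W))" using 1(2) assms(1) by simp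
    then show ?thesis using that(1)[OF 1(4) _ _ 1(5)] 1(3) assms(2) by (auto simp: possibilities_def)
  next
    case (2 A B)
    have sub: "{..<N} \<inter> (A \<union> B) = A \<union> B" using weighing_even(1)[OF 2(1)] by auto
    show ?thesis
    proof (cases "A \<union> B = {..<N}")
      case True
      then show ?thesis using that(3)[OF 2(1) True 2(3)] 2(5) by (simp add: possibilities_def)
    next
      case False
      then have "destined N t S"
        using 2(3,4) t weighing_even(1)[OF 2(1)] sub by (auto simp: destined_def)
      moreover have "card S = card (A \<union> B)" using card_image[OF 2(3)] 2(4) sub by simp
      ultimately show ?thesis using that(2) weighing_even(2)[OF 2(1)] by simp
    qed
  qed
qed

context coin_goal
begin

lemma not_goal_possibilities: "N \<ge> 2 \<Longrightarrow> \<not> goal (possibilities N)"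
  using goal_unknown[of "{..<N}"] by (auto simp: possibilities_def)

lemma grundy_normal_initial:
  assumes N: "even N" "N \<ge> 4" and t: "t \<in> possibilities N"
  shows "grundy (normal_moves goal N t) (possibilities N) = 0"
proof -
  let ?G = "grundy (normal_moves goal N t)"
  have "?G S \<noteq> 0" if "S \<in> moves N t (possibilities N)" for S
    using N(1) t that
  proof (cases rule: initial_move)
    case (1 Y)
    have fin: "finite Y" using 1(1) finite_subset by blast
    then have "card Y \<noteq> 0" "card Y \<noteq> 1" using 1(2,3) by auto
    then show ?thesis using grundy_normal_unknown[OF 1(1,2)] goal_unknown[of Y] 1(4) by auto
  next
    case 2
    then have "card S \<noteq> 1" by auto
    then show ?thesis
      using grundy_normal_destined[OF 2(1)] destined_card_pos[OF 2(1)] by simp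
  next
    case (3 A B)
    have tS: "t \<in> S" using 3(4) t by simp
    have fin: "finite S" using 3(4) finite_possibilities by simp
    \<comment> \<open>A move from \<open>S\<close> ends the game, so \<open>S\<close> has an option of value \<open>0\<close>.\<close>
    have move: "{t} \<in> moves N t S"
      using compare_same_destiny[OF 3(1,2,4) tS N(2)] .
    then have "{t} \<subset> S" by (rule move_subset)
    then have "card S \<noteq> 1" by (auto simp: card_1_singleton_iff)
    then have opts: "normal_moves goal N t S = moves N t S"
      using goal_inj[OF 3(3)] by (simp add: normal_moves_def)
    have "goal {t}" by (simp add: goal_inj)
    then have "?G {t} = 0" by (simp add: grundy_normal_rec[of goal N t "{t}"] normal_moves_def mex_empty)
    then have "0 \<in> ?G ` moves N t S" using move by force
    moreover have "finite (moves N t S)"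
      by (rule finite_subset[of _ "Pow S"]) (use fin in \<open>auto simp: moves_def\<close>)
    then have "?G S \<notin> ?G ` moves N t S"
      unfolding grundy_normal_rec[of goal N t S] opts by (intro mex_notin) simp
    ultimately show ?thesis by metis
  qed
  then have "\<forall>S\<in>moves N t (possibilities N). 0 \<noteq> ?G S" by (simp add: neq_iff)
  then have "0 \<notin> ?G ` moves N t (possibilities N)" by blast
  moreover have "normal_moves goal N t (possibilities N) = moves N t (possibilities N)"
    using not_goal_possibilities N(2) by (simp add: normal_moves_def)
  ultimately show ?thesis
    unfolding grundy_normal_rec[of goal N t "possibilities N"] by (intro mex_eqI) auto
qed

lemma grundy_misere_initial:
  assumes N: "even N" "N \<ge> 4" and t: "t \<in> possibilities N"
  shows "grundy (misere_moves goal N t) (possibilities N) = N - 2"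
proof -
  let ?G = "grundy (misere_moves goal N t)" and ?P = "possibilities N"
  have opts: "misere_moves goal N t ?P = {S \<in> moves N t ?P. \<not> goal S}"
    using not_goal_possibilities N(2) by (auto simp: misere_moves_def normal_moves_def)
  have fst_t: "fst t < N" using t by (auto simp: possibilities_def)
  have ne: "?G S \<noteq> N - 2" if "S \<in> moves N t ?P" for S
    using N(1) t that
  proof (cases rule: initial_move)
    case (1 Y)
    have "finite Y" using 1(1) finite_subset by blast
    then have "card Y \<noteq> 0" using 1(2) by auto
    then have "odd (card Y - 1)" using 1(3) by simp
    moreover have "even (N - 2)" using N(1) by simp
    ultimately have "card Y - 1 \<noteq> N - 2" by metis
    then show ?thesis using grundy_misere_unknown[OF 1(1,2)] 1(4) by simp
  next
    case 2
    then show ?thesis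
      using grundy_misere_destined[OF 2(1)] destined_card_lt[OF 2(1)] N(2) by simp
  next
    case (3 A B)
    have tS: "t \<in> S" using 3(4) t by simp
    have fstS: "fst ` S \<subseteq> {..<N}" using 3(4) by (auto simp: possibilities_def)
    \<comment> \<open>Only an option with \<open>N - 1\<close> possibilities could have the value \<open>N - 3\<close>.\<close>
    have "?G T \<noteq> N - 3" if T: "T \<in> moves N t S" for T
    proof -
      have "T \<subset> S" and "t \<in> T" using move_subset[OF T] truth_in_move[OF tS T] by auto
      then have "destined N t T"
        using inj_on_subset[OF 3(3)] image_strict_mono[OF 3(3) \<open>T \<subset> S\<close>] \<open>T \<subset> S\<close> fstS
        unfolding destined_def by blast
      then have "?G T = card T - 2" and "card T < N"
        by (rule grundy_misere_destined, rule destined_card_lt)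
      then show ?thesis using no_single_exclusion[OF 3(1,2,4) tS T] N(2) by simp
    qed
    moreover have "misere_moves goal N t S \<subseteq> moves N t S"
      by (auto simp: misere_moves_def normal_moves_def)
    ultimately have "\<forall>T\<in>misere_moves goal N t S. N - 3 \<noteq> ?G T" by (metis subsetD)
    then have "N - 3 \<notin> ?G ` misere_moves goal N t S" by blast
    then have "?G S \<le> N - 3"
      unfolding grundy_misere_rec[of goal N t S] by (rule mex_le)
    then show ?thesis using N(2) by simp
  qed
  show ?thesis unfolding grundy_misere_rec[of goal N t ?P] opts
  proof (rule mex_eqI)
    show "N - 2 \<notin> ?G ` {S \<in> moves N t ?P. \<not> goal S}" using ne by force
  next
    show "{..<N - 2} \<subseteq> ?G ` {S \<in> moves N t ?P. \<not> goal S}"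
    proof
      fix n assume n: "n \<in> {..<N - 2}"
      show "n \<in> ?G ` {S \<in> moves N t ?P. \<not> goal S}"
      proof (cases "even n")
        case True
        \<comment> \<open>An unbalanced weighing of \<open>n + 2\<close> coins, fewer than \<open>N\<close>, has the value \<open>n\<close>.\<close>
        obtain W where W: "fst t \<in> W" "W \<subseteq> {..<N}" "card W = n + 2"
        proof (rule subset_with_member)
          show "fst t \<in> {..<N}" "n + 2 \<le> card {..<N}" using n fst_t by auto
        qed auto
        have "even (card W)" using W(3) True by simp
        then obtain S where S: "S \<in> moves N t ?P" "inj_on fst S" "fst ` S = {..<N} \<inter> W"
          using unknown_to_destined[OF W(2), of t "{..<N}"] W(1) fst_t
          unfolding possibilities_def by auto
        have "fst ` S = W" using S(3) W(2) by auto
        moreover from this have "card S = n + 2" using card_image[OF S(2)] W(3) by simp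
        moreover have "W \<noteq> {..<N}" using W(3) n by auto
        ultimately have "destined N t S" "\<not> goal S"
          using S W(2) truth_in_move[OF t S(1)] goal_inj[OF S(2)] by (auto simp: destined_def)
        then show ?thesis
          using grundy_misere_destined[of N t S] S(1) \<open>card S = n + 2\<close>
          by (intro image_eqI[of _ _ S]) auto
      next
        case False
        \<comment> \<open>A balanced weighing of all but \<open>n + 1\<close> coins has the value \<open>n\<close>.\<close>
        obtain Y where Y: "fst t \<in> Y" "Y \<subseteq> {..<N}" "card Y = n + 1"
        proof (rule subset_with_member)
          show "fst t \<in> {..<N}" "n + 1 \<le> card {..<N}" using n fst_t by auto
        qed auto
        define W where "W = {..<N} - Y"
        have fin: "finite Y" using Y(2) finite_subset by blast
        have Y': "Y \<subset> {..<N}" using Y n by auto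
        have W: "{..<N} - W = Y" using Y(2) by (auto simp: W_def)
        have "card W = N - (n + 1)" using fin Y by (simp add: W_def card_Diff_subset)
        then have "even (card W)" using N(1) False n by auto
        then have "Y \<times> UNIV \<in> moves N t ?P"
          using unknown_to_unknown[of W N t "{..<N}"] Y(1) Y' unfolding W possibilities_def
          by (auto simp: W_def)
        moreover have "card Y \<noteq> 1" using Y(3) False by (cases n) auto
        then have "\<not> goal (Y \<times> UNIV)" using goal_unknown by blast
        ultimately show ?thesis
          using grundy_misere_unknown[OF Y' Y(1)] Y(3)
          by (intro image_eqI[of _ _ "Y \<times> UNIV"]) auto
      qed
    qed
  qed
qed

end

lemma coin_goal_found: "coin_goal coin_found"
proof
  fix S :: "possibility set"
  assume "inj_on fst S"
  then have "card (fst ` S) = card S" by (rule card_image)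
  then show "coin_found S \<longleftrightarrow> card S = 1"
    by (metis One_nat_def card_1_singleton_iff coin_found_def)
next
  fix X :: "nat set"
  assume "coin_found (X \<times> UNIV)"
  then show "card X = 1" by (auto simp: coin_found_def)
qed

lemma coin_goal_identified: "coin_goal coin_identified"
proof
  fix S :: "possibility set"
  show "coin_identified S \<longleftrightarrow> card S = 1"
    by (simp add: coin_identified_def card_1_singleton_iff)
next
  fix X :: "nat set"
  assume "coin_identified (X \<times> UNIV)"
  then obtain p where p: "X \<times> (UNIV :: bias set) = {p}"
    unfolding coin_identified_def by blast
  then have "p \<in> X \<times> UNIV" by simp
  then have "fst p \<in> X" by (rule mem_Times_iff[THEN iffD1, THEN conjunct1])
  then have "(fst p, Lighter) = p" and "(fst p, Heavier) = p" using p by blast+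
  then have False by (metis bias.distinct(1) snd_conv)
  then show "card X = 1" ..
qed

theorem lemma9:
  fixes N k :: nat and t :: possibility
  assumes "N = 2 * k" and "k \<ge> 2" and "t \<in> possibilities N"
  shows "grundy_F N t = 0 \<and> grundy_FI N t = 0 \<and>
         grundy_FM N t = N - 2 \<and> grundy_FIM N t = N - 2"
proof -
  have N: "even N" "N \<ge> 4" using assms by auto
  interpret found: coin_goal coin_found by (rule coin_goal_found)
  interpret identified: coin_goal coin_identified by (rule coin_goal_identified)
  show ?thesis
    unfolding grundy_F_def grundy_FI_def grundy_FM_def grundy_FIM_def
    using found.grundy_normal_initial[OF N assms(3)] found.grundy_misere_initial[OF N assms(3)]
      identified.grundy_normal_initial[OF N assms(3)]
      identified.grundy_misere_initial[OF N assms(3)]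
    by blast
qed

end
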